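(* Let $N\ge2$, $m=\lceil\sqrt{2N}\,\rceil$, and consider $f(x)=\frac{\varepsilon}{2R}\,|x-x_\star|$ on $\mathbb R$ with minimizer $x_\star=x_0+R$. Run, with zero noise, the subgradient method $x_{k+1}=x_k-h_kg_k$, $g_k\in\partial f(x_k)$, $k=0,\dots,N-1$, with the stochastic harmonic schedule $$h_k=\frac{R^2}{\varepsilon\,(N+m-k)},\qquad k=0,\dots,N-1,$$ and uniform averaging $x_A=\frac1{N+1}\sum_{k=0}^Nx_k$. Then $$f(x_A)-f_\star\;\ge\;\frac\varepsilon4 .$$
   Context: Here $x_0\in\mathbb R$ is the starting point, $R,L>0$, $\varepsilon\in(0,RL)$, and $f_\star=f(x_\star)=0$. The function $f$ belongs to the class $\mathcal C(R,L)$ of convex functions having a minimizer within distance $R$ of $x_0$ and all subgradients bounded by $L$ in absolute value. *)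

theory Defs
  imports "HOL-Analysis.Analysis"
begin

definition subdifferential :: "(real \<Rightarrow> real) \<Rightarrow> real \<Rightarrow> real set" where
  "subdifferential f x = {g. \<forall>y. f y \<ge> f x + g * (y - x)}"

definition objective_class :: "real \<Rightarrow> real \<Rightarrow> real \<Rightarrow> (real \<Rightarrow> real) set" where
  "objective_class x0 R L =
     {f. convex_on UNIV f \<and>
         (\<exists>z. is_arg_min f (\<lambda>_. True) z \<and> dist x0 z \<le> R) \<and>
         (\<forall>x. \<forall>g\<in>subdifferential f x. \<bar>g\<bar> \<le> L)}"

text \<open>Only the values of \<open>x\<close> at \<open>0, \<dots>, N\<close> and of \<open>g\<close> and \<open>h\<close> at \<open>0, \<dots>, N - 1\<close> are
  constrained or used. The choice of subgradients is arbitrary.\<close>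

definition subgradient_run ::
  "(real \<Rightarrow> real) \<Rightarrow> (nat \<Rightarrow> real) \<Rightarrow> nat \<Rightarrow> real \<Rightarrow> (nat \<Rightarrow> real) \<Rightarrow> (nat \<Rightarrow> real) \<Rightarrow> bool" where
  "subgradient_run f h N x0 x g \<longleftrightarrow>
     x 0 = x0 \<and>
     (\<forall>k<N. g k \<in> subdifferential f (x k) \<and> x (Suc k) = x k - h k * g k)"

definition stochastic_harmonic_schedule ::
  "real \<Rightarrow> real \<Rightarrow> nat \<Rightarrow> nat \<Rightarrow> nat \<Rightarrow> real" where
  "stochastic_harmonic_schedule R \<epsilon> N m k = R\<^sup>2 / (\<epsilon> * (real N + real m - real k))"

definition uniform_average :: "nat \<Rightarrow> (nat \<Rightarrow> real) \<Rightarrow> real" where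
  "uniform_average N x = (\<Sum>k=0..N. x k) / (real N + 1)"

text \<open>Scaled absolute values with slope at most \<open>L\<close> lie in the class, so for them the
  assumption of membership excludes nothing.\<close>

lemma scaled_abs_in_objective_class:
  fixes x0 R L c z :: real
  assumes "0 \<le> c" "c \<le> L" "dist x0 z \<le> R"
  shows "(\<lambda>x. c * \<bar>x - z\<bar>) \<in> objective_class x0 R L"
proof -
  let ?f = "\<lambda>x. c * \<bar>x - z\<bar>"
  have "convex_on UNIV (\<lambda>x. dist z x)"
    by (rule convex_on_dist) simp
  then have "convex_on UNIV (\<lambda>x. \<bar>x - z\<bar>)"
    by (simp add: dist_real_def abs_minus_commute)
  then have "convex_on UNIV ?f"
    using assms(1) by (rule convex_on_cmul[rotated])
  moreover have "is_arg_min ?f (\<lambda>_. True) z"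
    using assms(1) by (auto simp: is_arg_min_def not_less)
  moreover have "\<bar>g\<bar> \<le> L" if "g \<in> subdifferential ?f x" for g x
  proof -
    have sub: "?f x + g * (y - x) \<le> ?f y" for y
      using that by (auto simp: subdifferential_def)
    have lip: "?f y - ?f x \<le> c * \<bar>y - x\<bar>" for y
    proof -
      have "c * (\<bar>y - z\<bar> - \<bar>x - z\<bar>) \<le> c * \<bar>y - x\<bar>"
        using assms(1) by (intro mult_left_mono) auto
      then show ?thesis by (simp add: right_diff_distrib)
    qed
    have "g \<le> c" using sub[of "x + 1"] lip[of "x + 1"] by simp
    moreover have "- g \<le> c" using sub[of "x - 1"] lip[of "x - 1"] by simp
    ultimately show ?thesis using assms(2) by linarith
  qed
  ultimately show ?thesis
    using assms(3) unfolding objective_class_def by blast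
qed

end

theory Submission
  imports Defs
begin

text \<open>Every subgradient of \<open>f\<close> is at least \<open>- \<epsilon> / (2 * R)\<close>, so whichever subgradients are chosen, the
  iterate moves to the right by at most \<open>R / (2 * (N + m - j))\<close> in step \<open>j\<close>. In the sum of the
  iterates this increment is counted \<open>N - j\<close> times, so each step contributes at most \<open>R / 2\<close>. Hence
  the average lies at most \<open>R / 2\<close> to the right of \<open>x0\<close>, at distance at least \<open>R / 2\<close> from the
  minimizer.\<close>

text \<open>Increment \<open>j\<close> enters exactly the iterates \<open>x (Suc j)\<close>, ...,
  \<open>x n\<close>, hence the weight \<open>n - j\<close>.\<close>

lemma sum_iterates_by_increments:
  fixes x :: "nat \<Rightarrow> real"
  shows "(\<Sum>k=0..n. x k) = (real n + 1) * x 0 + (\<Sum>j<n. (real n - real j) * (x (Suc j) - x j))"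
proof (induction n)
  case 0
  then show ?case by simp
next
  case (Suc n)
  \<comment> \<open>Raising \<open>n\<close> by one adds one copy of every increment. In the first
    sum on the right the term \<open>j = n\<close> has weight zero, so the induction hypothesis
    fits.\<close>
  have "(\<Sum>j<Suc n. (real (Suc n) - real j) * (x (Suc j) - x j)) =
      (\<Sum>j<Suc n. (real n - real j) * (x (Suc j) - x j)) + (\<Sum>j<Suc n. x (Suc j) - x j)"
    by (subst sum.distrib[symmetric], rule sum.cong) (auto simp: algebra_simps)
  also have "(\<Sum>j<Suc n. x (Suc j) - x j) = x (Suc n) - x 0"
    by (rule sum_lessThan_telescope)
  finally show ?case using Suc.IH by (simp add: algebra_simps)
qed

text \<open>Test the subgradient inequality at \<open>x - 1\<close>: a unit step changes the
  function by at most \<open>c\<close>.\<close>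

lemma subdifferential_scaled_abs_ge:
  assumes "g \<in> subdifferential (\<lambda>y. c * \<bar>y - z\<bar>) x" "0 \<le> c"
  shows "- c \<le> g"
proof -
  have "c * \<bar>x - z\<bar> - g \<le> c * \<bar>x - 1 - z\<bar>"
    using assms(1) by (force simp: subdifferential_def dest: spec[of _ "x - 1"])
  also have "\<dots> \<le> c * (\<bar>x - z\<bar> + 1)"
    using assms(2) by (intro mult_left_mono) auto
  finally show ?thesis by (simp add: algebra_simps)
qed

theorem lemma5:
  fixes x0 xstar R L \<epsilon> :: real
    and N m :: nat
    and f :: "real \<Rightarrow> real"
    and x g :: "nat \<Rightarrow> real"
  assumes "R > 0" and "L > 0"
    and "0 < \<epsilon>" and "\<epsilon> < R * L"
    and "N \<ge> 2"
    and "m = nat \<lceil>sqrt (2 * real N)\<rceil>"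
    and "xstar = x0 + R"
    and "f = (\<lambda>y. \<epsilon> / (2 * R) * \<bar>y - xstar\<bar>)"
    and "f \<in> objective_class x0 R L"
    and "subgradient_run f (stochastic_harmonic_schedule R \<epsilon> N m) N x0 x g"
  shows "f (uniform_average N x) - f xstar \<ge> \<epsilon> / 4"
proof -
  define c where "c = \<epsilon> / (2 * R)"
  have c: "0 \<le> c" using assms(1,3) by (simp add: c_def)
  let ?h = "stochastic_harmonic_schedule R \<epsilon> N m"
  have x_0: "x 0 = x0"
    using assms(10) by (simp add: subgradient_run_def)
  have g: "g k \<in> subdifferential (\<lambda>y. c * \<bar>y - xstar\<bar>) (x k)"
    and step: "x (Suc k) = x k - ?h k * g k" if "k < N" for k
    using assms(10) that unfolding subgradient_run_def assms(8) c_def by auto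
  have increment: "(real N - real j) * (x (Suc j) - x j) \<le> R / 2" if j: "j < N" for j
  proof -
    have h: "0 \<le> ?h j"
      using assms(3) j by (simp add: stochastic_harmonic_schedule_def)
    have "x (Suc j) - x j = ?h j * (- g j)"
      using step[OF j] by simp
    also have "\<dots> \<le> ?h j * c"
      using subdifferential_scaled_abs_ge[OF g[OF j] c] h by (intro mult_left_mono) auto
    also have "\<dots> = R / (2 * (real N + real m - real j))"
      using assms(1,3) j
      by (simp add: stochastic_harmonic_schedule_def c_def power2_eq_square)
    finally have "(real N - real j) * (x (Suc j) - x j)
        \<le> (real N - real j) * (R / (2 * (real N + real m - real j)))"
      using j by (intro mult_left_mono) auto
    \<comment> \<open>The ratio of \<open>N - j\<close> to \<open>N + m - j\<close> is at most
      one.\<close>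
    also have "\<dots> \<le> R / 2"
      using assms(1) j by (simp add: field_simps)
    finally show ?thesis .
  qed
  have "(\<Sum>k=0..N. x k) \<le> (real N + 1) * x0 + (\<Sum>j<N. R / 2)"
    unfolding sum_iterates_by_increments x_0
    by (intro add_left_mono sum_mono increment) simp
  \<comment> \<open>There are \<open>N\<close> increments but \<open>N + 1\<close> iterates.\<close>
  also have "\<dots> \<le> (x0 + R / 2) * (real N + 1)"
    using assms(1) by (simp add: algebra_simps)
  finally have "uniform_average N x \<le> x0 + R / 2"
    by (simp add: uniform_average_def pos_divide_le_eq)
  then have "R / 2 \<le> \<bar>uniform_average N x - xstar\<bar>"
    using assms(7) by linarith
  then have "c * (R / 2) \<le> c * \<bar>uniform_average N x - xstar\<bar>"
    using c by (rule mult_left_mono)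
  \<comment> \<open>Here \<open>c * (R / 2)\<close> equals \<open>\<epsilon> / 4\<close>, and
    \<open>f xstar\<close> is zero.\<close>
  then show ?thesis
    using assms(1) by (simp add: assms(8) c_def)
qed

end
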